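(* For every integer $n\ge1$, there is a bijection between $\mathcal{U}_n^K$ and $\mathcal{U}_{n-1}^K\cup\mathcal{U}_{n-1}^S\cup\mathcal{B}_{n-1}^{KS}$, and $|\mathcal{U}_n|=|\mathcal{T}_{\le n-1}|$.
   Context: Graphs are finite and simple; $\omega,\alpha$ are clique and independence numbers. A KS-partition of $G$ is a partition $V(G)=K\cup S$ with $K$ a clique and $S$ a stable set; a split graph is one having a KS-partition; the KS-partition is $K$-max if $|K|=\omega(G)$ and $S$-max if $|S|=\alpha(G)$. A split graph is balanced if it has a KS-partition that is both $K$-max and $S$-max (such a partition is then unique), unbalanced otherwise. $\mathcal{U}_n$ is the set of unlabeled unbalanced split graphs on $n$ vertices. $\mathcal{U}_n^K$ (resp. $\mathcal{U}_n^S$) is the set of triples $(G,K_G,S_G)$ with $G$ an unlabeled unbalanced split graph on $n$ vertices and $K_G\cup S_G$ a $K$-max (resp. $S$-max) KS-partition of $G$, triples being identified up to isomorphism. $\mathcal{B}_n^{KS}$ is the set of triples $(G,K_G,S_G)$ with $G$ an unlabeled balanced split graph on $n$ vertices and $K_G\cup S_G$ its unique KS-partition (with $\mathcal{B}_0^{KS}$ consisting of the null graph). $\mathcal{T}_{\le k}$ is the set of unlabeled split graphs on at most $k$ vertices, including the graph on $0$ vertices. *)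

theory Defs
  imports "Graph_Theory.Graph_Theory"
begin

text \<open>A finite simple graph is a library \<^locale>\<open>pair_graph\<close>: finite, loop-free, with a
  symmetric arc relation.\<close>

definition is_clique :: "'a pair_pre_digraph \<Rightarrow> 'a set \<Rightarrow> bool" where
  "is_clique G K \<longleftrightarrow> K \<subseteq> pverts G \<and> (\<forall>u\<in>K. \<forall>v\<in>K. u \<noteq> v \<longrightarrow> (u, v) \<in> parcs G)"

definition is_stable :: "'a pair_pre_digraph \<Rightarrow> 'a set \<Rightarrow> bool" where
  "is_stable G S \<longleftrightarrow> S \<subseteq> pverts G \<and> (\<forall>u\<in>S. \<forall>v\<in>S. (u, v) \<notin> parcs G)"

text \<open>The empty set is both a clique and a stable set, so both numbers are 0 for the null graph,
  and either part of a KS-partition may be empty.\<close>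

definition clique_number :: "'a pair_pre_digraph \<Rightarrow> nat" where
  "clique_number G = Max (card ` {K. is_clique G K})"

definition independence_number :: "'a pair_pre_digraph \<Rightarrow> nat" where
  "independence_number G = Max (card ` {S. is_stable G S})"

definition KS_partition :: "'a pair_pre_digraph \<Rightarrow> 'a set \<Rightarrow> 'a set \<Rightarrow> bool" where
  "KS_partition G K S \<longleftrightarrow>
     K \<union> S = pverts G \<and> K \<inter> S = {} \<and> is_clique G K \<and> is_stable G S"

definition K_max_partition :: "'a pair_pre_digraph \<Rightarrow> 'a set \<Rightarrow> 'a set \<Rightarrow> bool" where
  "K_max_partition G K S \<longleftrightarrow> KS_partition G K S \<and> card K = clique_number G"

definition S_max_partition :: "'a pair_pre_digraph \<Rightarrow> 'a set \<Rightarrow> 'a set \<Rightarrow> bool" where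
  "S_max_partition G K S \<longleftrightarrow> KS_partition G K S \<and> card S = independence_number G"

definition split_graph :: "'a pair_pre_digraph \<Rightarrow> bool" where
  "split_graph G \<longleftrightarrow> pair_graph G \<and> (\<exists>K S. KS_partition G K S)"

definition balanced_split_graph :: "'a pair_pre_digraph \<Rightarrow> bool" where
  "balanced_split_graph G \<longleftrightarrow>
     split_graph G \<and> (\<exists>K S. K_max_partition G K S \<and> S_max_partition G K S)"

definition unbalanced_split_graph :: "'a pair_pre_digraph \<Rightarrow> bool" where
  "unbalanced_split_graph G \<longleftrightarrow> split_graph G \<and> \<not> balanced_split_graph G"

definition is_graph_iso ::
    "('a \<Rightarrow> 'b) \<Rightarrow> 'a pair_pre_digraph \<Rightarrow> 'b pair_pre_digraph \<Rightarrow> bool" where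
  "is_graph_iso f G H \<longleftrightarrow> bij_betw f (pverts G) (pverts H) \<and>
     (\<forall>u\<in>pverts G. \<forall>v\<in>pverts G. (u, v) \<in> parcs G \<longleftrightarrow> (f u, f v) \<in> parcs H)"

type_synonym 'a KS_triple = "'a pair_pre_digraph \<times> 'a set \<times> 'a set"

text \<open>Every finite graph has an isomorphic copy with vertices in \<^typ>\<open>nat\<close>. An unlabeled graph
  (an unlabeled triple) is therefore rendered as an isomorphism class of graphs (of triples)
  over \<^typ>\<open>nat\<close>. An isomorphism of triples is a graph isomorphism that carries the clique part
  to the clique part and the stable part to the stable part.\<close>

definition graph_iso_rel :: "nat pair_pre_digraph rel" where
  "graph_iso_rel = {(G, H). pair_graph G \<and> pair_graph H \<and> (\<exists>f. is_graph_iso f G H)}"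

definition triple_iso_rel :: "nat KS_triple rel" where
  "triple_iso_rel = {((G, K, S), (H, L, T)).
     pair_graph G \<and> KS_partition G K S \<and> pair_graph H \<and> KS_partition H L T \<and>
     (\<exists>f. is_graph_iso f G H \<and> f ` K = L \<and> f ` S = T)}"

definition unlabeled_unbalanced :: "nat \<Rightarrow> nat pair_pre_digraph set set" where
  "unlabeled_unbalanced n =
     {G. unbalanced_split_graph G \<and> card (pverts G) = n} // graph_iso_rel"

definition unlabeled_split_le :: "nat \<Rightarrow> nat pair_pre_digraph set set" where
  "unlabeled_split_le k = {G. split_graph G \<and> card (pverts G) \<le> k} // graph_iso_rel"

definition unbalanced_K_max :: "nat \<Rightarrow> nat KS_triple set set" where
  "unbalanced_K_max n =
     {(G, K, S). unbalanced_split_graph G \<and> card (pverts G) = n \<and> K_max_partition G K S}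
       // triple_iso_rel"

definition unbalanced_S_max :: "nat \<Rightarrow> nat KS_triple set set" where
  "unbalanced_S_max n =
     {(G, K, S). unbalanced_split_graph G \<and> card (pverts G) = n \<and> S_max_partition G K S}
       // triple_iso_rel"

text \<open>A balanced split graph has exactly one KS-partition, so no further condition on \<open>K\<close> and
  \<open>S\<close> is needed to single it out.\<close>

definition balanced_KS :: "nat \<Rightarrow> nat KS_triple set set" where
  "balanced_KS n =
     {(G, K, S). balanced_split_graph G \<and> card (pverts G) = n \<and> KS_partition G K S}
       // triple_iso_rel"

lemma is_graph_iso_id: "is_graph_iso (\<lambda>x. x) G G"
  by (simp add: is_graph_iso_def bij_betw_def)

lemma is_graph_iso_inv:
  assumes "is_graph_iso f G H"
  shows "is_graph_iso (inv_into (pverts G) f) H G"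
proof -
  let ?g = "inv_into (pverts G) f"
  have bij: "bij_betw f (pverts G) (pverts H)"
    and arcs: "\<And>u v. u \<in> pverts G \<Longrightarrow> v \<in> pverts G \<Longrightarrow>
      (u, v) \<in> parcs G \<longleftrightarrow> (f u, f v) \<in> parcs H"
    using assms by (auto simp: is_graph_iso_def)
  have g: "?g x \<in> pverts G" "f (?g x) = x" if "x \<in> pverts H" for x
    using that bij bij_betw_inv_into_right[OF bij] bij_betwE[OF bij_betw_inv_into[OF bij]]
    by auto
  show ?thesis
    unfolding is_graph_iso_def
    using bij_betw_inv_into[OF bij] g arcs by simp
qed

lemma is_graph_iso_comp:
  assumes "is_graph_iso f G H" "is_graph_iso g H J"
  shows "is_graph_iso (g \<circ> f) G J"
proof -
  have "bij_betw (g \<circ> f) (pverts G) (pverts J)"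
    using assms unfolding is_graph_iso_def by (blast intro: bij_betw_trans)
  moreover have "f u \<in> pverts H" if "u \<in> pverts G" for u
    using that assms unfolding is_graph_iso_def by (blast dest: bij_betwE)
  ultimately show ?thesis using assms unfolding is_graph_iso_def by simp
qed

lemma equiv_graph_iso_rel: "equiv {G. pair_graph G} graph_iso_rel"
  unfolding equiv_def
proof (intro conjI)
  show "graph_iso_rel \<subseteq> {G. pair_graph G} \<times> {G. pair_graph G}"
    by (auto simp: graph_iso_rel_def)
  show "refl_on {G. pair_graph G} graph_iso_rel"
    by (auto simp: refl_on_def graph_iso_rel_def intro: is_graph_iso_id)
  show "sym graph_iso_rel"
    by (auto simp: sym_def graph_iso_rel_def intro: is_graph_iso_inv)
  show "trans graph_iso_rel"
    by (auto simp: trans_def graph_iso_rel_def intro: is_graph_iso_comp)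
qed

lemma equiv_triple_iso_rel:
  "equiv {(G, K, S). pair_graph G \<and> KS_partition G K S} triple_iso_rel"
  unfolding equiv_def
proof (intro conjI)
  let ?A = "{(G, K, S). pair_graph G \<and> KS_partition G K S} :: nat KS_triple set"
  show "triple_iso_rel \<subseteq> ?A \<times> ?A"
    by (auto simp: triple_iso_rel_def)
  show "refl_on ?A triple_iso_rel"
    by (auto simp: refl_on_def triple_iso_rel_def intro!: exI[of _ "\<lambda>x. x"] is_graph_iso_id)
  show "sym triple_iso_rel"
  proof (rule symI, clarify)
    fix G H :: "nat pair_pre_digraph" and K S L T
    assume "((G, K, S), (H, L, T)) \<in> triple_iso_rel"
    then obtain f where r: "pair_graph G" "KS_partition G K S" "pair_graph H" "KS_partition H L T"
      and f: "is_graph_iso f G H" "f ` K = L" "f ` S = T"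
      by (auto simp: triple_iso_rel_def)
    let ?g = "inv_into (pverts G) f"
    have "inj_on f (pverts G)" "K \<subseteq> pverts G" "S \<subseteq> pverts G"
      using f r by (auto simp: is_graph_iso_def bij_betw_def KS_partition_def)
    then have "?g ` L = K" "?g ` T = S"
      using f(2,3) inv_into_image_cancel by metis+
    then show "((H, L, T), (G, K, S)) \<in> triple_iso_rel"
      using r is_graph_iso_inv[OF f(1)] by (auto simp: triple_iso_rel_def)
  qed
  show "trans triple_iso_rel"
  proof (rule transI, clarify)
    fix G H J :: "nat pair_pre_digraph" and K S L T M U
    assume "((G, K, S), (H, L, T)) \<in> triple_iso_rel" "((H, L, T), (J, M, U)) \<in> triple_iso_rel"
    then obtain f g where r: "pair_graph G" "KS_partition G K S" "pair_graph J" "KS_partition J M U"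
      and f: "is_graph_iso f G H" "f ` K = L" "f ` S = T"
      and g: "is_graph_iso g H J" "g ` L = M" "g ` T = U"
      by (auto simp: triple_iso_rel_def)
    have "(g \<circ> f) ` K = M" "(g \<circ> f) ` S = U"
      using f(2,3) g(2,3) by (auto simp only: image_comp [symmetric])
    then show "((G, K, S), (J, M, U)) \<in> triple_iso_rel"
      using r is_graph_iso_comp[OF f(1) g(1)] unfolding triple_iso_rel_def by blast
  qed
qed

end

theory Submission
  imports Defs
begin

text \<open>Call a vertex \<open>x\<close> swing if its neighbourhood is a clique and its set of non-neighbours is
  stable. A split graph is unbalanced iff it has a swing vertex; then its \<open>K\<close>-max (\<open>S\<close>-max)
  partitions are the ones that put \<open>x\<close> with its neighbours (non-neighbours) for some swing \<open>x\<close>.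
  Two swing vertices are twins, hence exchanged by an automorphism. So deleting a swing vertex,
  while recording its neighbours and non-neighbours, gives a bijection from unbalanced graphs on
  \<open>n\<close> vertices to KS-partitioned graphs on \<open>n - 1\<close> vertices, and an unbalanced graph has one
  \<open>K\<close>-max and one \<open>S\<close>-max partition up to isomorphism. With \<open>u\<^sub>m\<close>, \<open>b\<^sub>m\<close> the numbers of unbalanced
  and balanced graphs on \<open>m\<close> vertices this reads \<open>u\<^sub>m\<^sub>+\<^sub>1 = 2u\<^sub>m + b\<^sub>m\<close>, that is,
  \<open>u\<^sub>m\<^sub>+\<^sub>1 = u\<^sub>m + |\<T>\<^sub>m|\<close>.\<close>

section \<open>Quotients\<close>

text \<open>Sending \<open>q a\<close> to \<open>h a\<close> is well defined and injective because
  \<open>q\<close> and \<open>h\<close> identify the same elements of \<open>A\<close>. Hence it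
  does not matter which preimage \<open>inv_into\<close> picks.\<close>

lemma bij_betw_image_same_kernel:
  assumes "\<And>a b. a \<in> A \<Longrightarrow> b \<in> A \<Longrightarrow> q a = q b \<longleftrightarrow> h a = h b"
  shows "\<exists>f. bij_betw f (q ` A) (h ` A)"
proof (intro exI)
  let ?f = "\<lambda>X. h (inv_into A q X)"
  have f: "?f (q a) = h a" if "a \<in> A" for a
    using that assms[of "inv_into A q (q a)" a]
    by (simp add: inv_into_into f_inv_into_f)
  show "bij_betw ?f (q ` A) (h ` A)"
    unfolding bij_betw_def inj_on_def using f assms by (auto simp: image_iff)
qed

text \<open>The source of every bijection between sets of classes below. The correspondence
  \<open>R\<close> is a relation because a partitioned graph may have several swing vertices to
  delete, with different results. Totality on both sides gives a map and its surjectivity;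
  \<open>rs\<close> gives well-definedness from left to right and injectivity from right to
  left.\<close>

lemma bij_betw_quotients:
  assumes r: "equiv C r" "A \<subseteq> C" and s: "equiv D s" "B \<subseteq> D"
    and left: "\<And>a. a \<in> A \<Longrightarrow> \<exists>b\<in>B. R a b" and right: "\<And>b. b \<in> B \<Longrightarrow> \<exists>a\<in>A. R a b"
    and rs: "\<And>a b a' b'. a \<in> A \<Longrightarrow> b \<in> B \<Longrightarrow> a' \<in> A \<Longrightarrow> b' \<in> B \<Longrightarrow> R a b \<Longrightarrow> R a' b' \<Longrightarrow>
      (a, a') \<in> r \<longleftrightarrow> (b, b') \<in> s"
  shows "\<exists>f. bij_betw f (A // r) (B // s)"
proof -
  obtain c where c: "\<And>a. a \<in> A \<Longrightarrow> c a \<in> B \<and> R a (c a)"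
    using left by metis
  let ?q = "\<lambda>a. r `` {a}" and ?h = "\<lambda>a. s `` {c a}"
  have "?q a = ?q b \<longleftrightarrow> ?h a = ?h b" if "a \<in> A" "b \<in> A" for a b
  proof -
    have "?q a = ?q b \<longleftrightarrow> (a, b) \<in> r"
      using that r by (meson eq_equiv_class_iff subsetD)
    moreover have "?h a = ?h b \<longleftrightarrow> (c a, c b) \<in> s"
      using that c s by (meson eq_equiv_class_iff subsetD)
    ultimately show ?thesis using that c rs by metis
  qed
  then have "\<exists>f. bij_betw f (?q ` A) (?h ` A)"
    by (rule bij_betw_image_same_kernel)
  moreover have "?q ` A = A // r"
    by (auto simp: quotient_def)
  moreover have "?h ` A = B // s"
  proof (intro equalityI subsetI)
    fix X assume "X \<in> ?h ` A"
    then show "X \<in> B // s" using c by (auto intro: quotientI)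
  next
    fix X assume "X \<in> B // s"
    then obtain b where b: "b \<in> B" "X = s `` {b}" by (auto elim: quotientE)
    then obtain a where a: "a \<in> A" "R a b" using right by blast
    \<comment> \<open>Reflexivity lets \<open>rs\<close> be used with \<open>a' = a\<close>: two
      partners of the same \<open>a\<close> are \<open>s\<close>-equivalent, so the chosen partner
      \<open>c a\<close> lies in the class of \<open>b\<close>.\<close>
    then have "(a, a) \<in> r"
      using r by (meson equiv_class_self in_mono Image_singleton_iff)
    then have "(c a, b) \<in> s"
      using rs[of a "c a" a b] a b c by blast
    then show "X \<in> ?h ` A"
      using equiv_class_eq[OF s(1)] a b by blast
  qed
  ultimately show ?thesis by simp
qed

lemma quotient_Un: "(A \<union> B) // r = A // r \<union> B // r"
  by (auto simp: quotient_def)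

lemma quotient_mono: "A \<subseteq> B \<Longrightarrow> A // r \<subseteq> B // r"
  by (auto simp: quotient_def)

lemma quotient_Int_empty:
  assumes "equiv C r" "A \<subseteq> C" "B \<subseteq> C" "\<And>a b. a \<in> A \<Longrightarrow> b \<in> B \<Longrightarrow> (a, b) \<notin> r"
  shows "A // r \<inter> B // r = {}"
proof (rule ccontr)
  assume "A // r \<inter> B // r \<noteq> {}"
  then obtain a b where "a \<in> A" "b \<in> B" "r `` {a} = r `` {b}"
    by (auto elim!: quotientE)
  then show False
    using assms eq_equiv_class_iff[OF assms(1)] by blast
qed

section \<open>Graphs and isomorphisms\<close>

lemma pair_graph_iff:
  "pair_graph G \<longleftrightarrow> finite (pverts G) \<and> parcs G \<subseteq> pverts G \<times> pverts G \<and> sym (parcs G) \<and>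
     (\<forall>v. (v, v) \<notin> parcs G)"
proof
  assume "pair_graph G"
  then interpret pair_graph G .
  show "finite (pverts G) \<and> parcs G \<subseteq> pverts G \<times> pverts G \<and> sym (parcs G) \<and>
     (\<forall>v. (v, v) \<notin> parcs G)"
    using pair_finite_verts wellformed' pair_sym_arcs pair_no_loops
    by (fastforce simp: symmetric_def)
next
  assume G: "finite (pverts G) \<and> parcs G \<subseteq> pverts G \<times> pverts G \<and> sym (parcs G) \<and>
     (\<forall>v. (v, v) \<notin> parcs G)"
  then have "finite (parcs G)"
    by (meson finite_SigmaI finite_subset)
  with G show "pair_graph G"
    by unfold_locales (auto simp: symmetric_def)
qed

lemma pair_graphD:
  assumes "pair_graph G"
  shows "finite (pverts G)" "(u, v) \<in> parcs G \<Longrightarrow> u \<in> pverts G"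
    "(u, v) \<in> parcs G \<Longrightarrow> v \<in> pverts G" "(u, v) \<in> parcs G \<Longrightarrow> (v, u) \<in> parcs G"
    "(v, v) \<notin> parcs G"
  using assms by (auto simp: pair_graph_iff sym_def)

lemma graph_iso_relI:
  "pair_graph G \<Longrightarrow> pair_graph H \<Longrightarrow> is_graph_iso f G H \<Longrightarrow> (G, H) \<in> graph_iso_rel"
  by (auto simp: graph_iso_rel_def)

lemma triple_iso_relI:
  "pair_graph G \<Longrightarrow> KS_partition G K S \<Longrightarrow> pair_graph H \<Longrightarrow> KS_partition H L T \<Longrightarrow>
     is_graph_iso f G H \<Longrightarrow> f ` K = L \<Longrightarrow> f ` S = T \<Longrightarrow> ((G, K, S), (H, L, T)) \<in> triple_iso_rel"
  by (auto simp: triple_iso_rel_def)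

lemma is_graph_iso_card: "is_graph_iso f G H \<Longrightarrow> card (pverts G) = card (pverts H)"
  by (auto simp: is_graph_iso_def bij_betw_same_card)

lemma is_graph_iso_arcs:
  "is_graph_iso f G H \<Longrightarrow> u \<in> pverts G \<Longrightarrow> v \<in> pverts G \<Longrightarrow>
     (f u, f v) \<in> parcs H \<longleftrightarrow> (u, v) \<in> parcs G"
  by (auto simp: is_graph_iso_def)

lemma is_graph_iso_inj: "is_graph_iso f G H \<Longrightarrow> inj_on f (pverts G)"
  and is_graph_iso_image: "is_graph_iso f G H \<Longrightarrow> f ` pverts G = pverts H"
  by (auto simp: is_graph_iso_def bij_betw_def)

lemma is_clique_image:
  assumes "is_graph_iso f G H" "is_clique G K"
  shows "is_clique H (f ` K)"
proof -
  have K: "K \<subseteq> pverts G" using assms(2) by (simp add: is_clique_def)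
  then have "f ` K \<subseteq> pverts H"
    using is_graph_iso_image[OF assms(1)] by blast
  then show ?thesis
    using assms(2) is_graph_iso_arcs[OF assms(1)] subsetD[OF K] by (auto simp: is_clique_def)
qed

lemma is_stable_image:
  assumes "is_graph_iso f G H" "is_stable G S"
  shows "is_stable H (f ` S)"
proof -
  have S: "S \<subseteq> pverts G" using assms(2) by (simp add: is_stable_def)
  then have "f ` S \<subseteq> pverts H"
    using is_graph_iso_image[OF assms(1)] by blast
  then show ?thesis
    using assms(2) is_graph_iso_arcs[OF assms(1)] subsetD[OF S] by (auto simp: is_stable_def)
qed

lemma KS_partition_image:
  assumes "is_graph_iso f G H" "KS_partition G K S"
  shows "KS_partition H (f ` K) (f ` S)"
proof -
  have "K \<subseteq> pverts G" "S \<subseteq> pverts G" "K \<inter> S = {}" "K \<union> S = pverts G"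
    using assms(2) by (auto simp: KS_partition_def)
  then have "f ` K \<inter> f ` S = {}" "f ` K \<union> f ` S = pverts H"
    using is_graph_iso_inj[OF assms(1)] is_graph_iso_image[OF assms(1)]
      inj_on_image_Int[of f "pverts G" K S] image_Un[of f K S] by simp_all
  then show ?thesis
    using assms(2) is_clique_image[OF assms(1)] is_stable_image[OF assms(1)]
    by (simp add: KS_partition_def)
qed

text \<open>Every class contains a graph with vertex set \<open>{..<n}\<close>, obtained by
  numbering the vertices, and such a graph is determined by its arc set. Finiteness is what makes
  \<open>card\<close> additive over disjoint unions of classes in the counting.\<close>

lemma finite_unlabeled_graphs:
  "finite ({G. pair_graph G \<and> card (pverts G) = n} // graph_iso_rel)"
proof (rule finite_subset)
  show "finite ((\<lambda>E. graph_iso_rel `` {\<lparr>pverts = {..<n}, parcs = E\<rparr>}) ` Pow ({..<n} \<times> {..<n}))"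
    by simp
  show "{G. pair_graph G \<and> card (pverts G) = n} // graph_iso_rel
    \<subseteq> (\<lambda>E. graph_iso_rel `` {\<lparr>pverts = {..<n}, parcs = E\<rparr>}) ` Pow ({..<n} \<times> {..<n})"
  proof
    fix X assume "X \<in> {G. pair_graph G \<and> card (pverts G) = n} // graph_iso_rel"
    then obtain G where G: "pair_graph G" "card (pverts G) = n" "X = graph_iso_rel `` {G}"
      by (auto elim: quotientE)
    obtain h where h: "bij_betw h (pverts G) {..<n}"
      using ex_bij_betw_finite_nat[OF pair_graphD(1)[OF G(1)]] G(2) by (auto simp: atLeast0LessThan)
    let ?E = "map_prod h h ` parcs G"
    let ?H = "\<lparr>pverts = {..<n}, parcs = ?E\<rparr>"
    have inj: "h u = h v \<longleftrightarrow> u = v" if "u \<in> pverts G" "v \<in> pverts G" for u v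
      using that h by (auto simp: bij_betw_def inj_on_def)
    have E: "?E \<subseteq> {..<n} \<times> {..<n}"
      using bij_betwE[OF h] pair_graphD(2,3)[OF G(1)] by fastforce
    have "(v, v) \<notin> ?E" for v
    proof
      assume "(v, v) \<in> ?E"
      then obtain a b where ab: "(a, b) \<in> parcs G" "h a = h b" by auto
      then have "a = b" using inj pair_graphD(2,3)[OF G(1)] by blast
      then show False using ab pair_graphD(5)[OF G(1)] by blast
    qed
    moreover have "sym ?E"
      using pair_graphD(4)[OF G(1)] by (force simp: sym_def)
    ultimately have H: "pair_graph ?H" using E by (auto simp: pair_graph_iff)
    have "(u, v) \<in> parcs G \<longleftrightarrow> (h u, h v) \<in> ?E" if "u \<in> pverts G" "v \<in> pverts G" for u v
    proof
      assume "(h u, h v) \<in> ?E"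
      then obtain a b where ab: "(a, b) \<in> parcs G" "h u = h a" "h v = h b" by auto
      then show "(u, v) \<in> parcs G" using inj that pair_graphD(2,3)[OF G(1)] by metis
    qed force
    then have "is_graph_iso h G ?H" using h by (simp add: is_graph_iso_def)
    then have "X = graph_iso_rel `` {?H}"
      using equiv_class_eq[OF equiv_graph_iso_rel graph_iso_relI] G H by metis
    then show "X \<in> (\<lambda>E. graph_iso_rel `` {\<lparr>pverts = {..<n}, parcs = E\<rparr>}) ` Pow ({..<n} \<times> {..<n})"
      using E by blast
  qed
qed

section \<open>Swing vertices\<close>

definition nbrs :: "'a pair_pre_digraph \<Rightarrow> 'a \<Rightarrow> 'a set" where
  "nbrs G x = {v. (x, v) \<in> parcs G}"

definition non_nbrs :: "'a pair_pre_digraph \<Rightarrow> 'a \<Rightarrow> 'a set" where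
  "non_nbrs G x = pverts G - insert x (nbrs G x)"

definition swing :: "'a pair_pre_digraph \<Rightarrow> 'a \<Rightarrow> bool" where
  "swing G x \<longleftrightarrow> x \<in> pverts G \<and> is_clique G (nbrs G x) \<and> is_stable G (non_nbrs G x)"

definition delete_vertex :: "'a pair_pre_digraph \<Rightarrow> 'a \<Rightarrow> 'a pair_pre_digraph" where
  "delete_vertex G x =
     \<lparr>pverts = pverts G - {x}, parcs = {(u, v) \<in> parcs G. u \<noteq> x \<and> v \<noteq> x}\<rparr>"

lemma delete_vertex_sel [simp]:
  "pverts (delete_vertex G x) = pverts G - {x}"
  "(u, v) \<in> parcs (delete_vertex G x) \<longleftrightarrow> (u, v) \<in> parcs G \<and> u \<noteq> x \<and> v \<noteq> x"
  by (auto simp: delete_vertex_def)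

lemma pair_graph_delete_vertex: "pair_graph G \<Longrightarrow> pair_graph (delete_vertex G x)"
  by (auto simp: pair_graph_iff delete_vertex_def sym_def)

section \<open>Transport of neighbourhoods and swing vertices along isomorphisms\<close>

lemma nbrs_image:
  assumes "pair_graph G" "pair_graph H" "is_graph_iso f G H" "x \<in> pverts G"
  shows "f ` nbrs G x = nbrs H (f x)"
proof (intro equalityI subsetI)
  fix v assume "v \<in> nbrs H (f x)"
  then have v: "(f x, v) \<in> parcs H" by (simp add: nbrs_def)
  then obtain u where "u \<in> pverts G" "v = f u"
    using is_graph_iso_image[OF assms(3)] pair_graphD(3)[OF assms(2)] by blast
  with v show "v \<in> f ` nbrs G x"
    using is_graph_iso_arcs[OF assms(3)] assms(4) by (auto simp: nbrs_def)
next
  fix v assume "v \<in> f ` nbrs G x"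
  then show "v \<in> nbrs H (f x)"
    using is_graph_iso_arcs[OF assms(3)] assms(4) pair_graphD(3)[OF assms(1)]
    by (auto simp: nbrs_def)
qed

lemma non_nbrs_image:
  assumes "pair_graph G" "pair_graph H" "is_graph_iso f G H" "x \<in> pverts G"
  shows "f ` non_nbrs G x = non_nbrs H (f x)"
proof -
  have "nbrs G x \<subseteq> pverts G"
    using pair_graphD(3)[OF assms(1)] by (auto simp: nbrs_def)
  then have "f ` (pverts G - insert x (nbrs G x)) = f ` pverts G - f ` insert x (nbrs G x)"
    using assms(4) by (intro inj_on_image_set_diff[OF is_graph_iso_inj[OF assms(3)]]) auto
  then show ?thesis
    using nbrs_image[OF assms] is_graph_iso_image[OF assms(3)] by (simp add: non_nbrs_def)
qed

lemma swing_image: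
  assumes "pair_graph G" "pair_graph H" "is_graph_iso f G H" "swing G x"
  shows "swing H (f x)"
proof -
  have "x \<in> pverts G" using assms(4) by (simp add: swing_def)
  then show ?thesis
    using assms nbrs_image[OF assms(1-3)] non_nbrs_image[OF assms(1-3)]
      is_clique_image[OF assms(3)] is_stable_image[OF assms(3)] is_graph_iso_image[OF assms(3)]
    unfolding swing_def by (metis imageI)
qed

text \<open>Let \<open>v\<close> be a neighbour of \<open>x\<close> other than \<open>y\<close>. If
  \<open>x\<close> and \<open>y\<close> are adjacent, \<open>v\<close> and \<open>y\<close> both lie
  in the clique \<open>nbrs G x\<close>. If they are distinct and not adjacent, \<open>v\<close>
  outside \<open>nbrs G y\<close> would put the adjacent vertices \<open>x\<close> and
  \<open>v\<close> into the stable set \<open>non_nbrs G y\<close>. The other inclusion follows by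
  exchanging \<open>x\<close> and \<open>y\<close>.\<close>

lemma swing_twins:
  assumes G: "pair_graph G" and x: "swing G x" and y: "swing G y"
  shows "nbrs G x - {y} = nbrs G y - {x}"
proof -
  have "nbrs G x - {y} \<subseteq> nbrs G y" if x: "swing G x" and y: "swing G y" for x y
  proof
    fix v assume v: "v \<in> nbrs G x - {y}"
    have vV: "v \<in> pverts G" using v pair_graphD(3)[OF G] by (auto simp: nbrs_def)
    show "v \<in> nbrs G y"
    proof (cases "y \<in> nbrs G x")
      case True
      then show ?thesis using v x by (auto simp: swing_def is_clique_def nbrs_def)
    next
      case False
      show ?thesis
      proof (rule ccontr)
        assume "v \<notin> nbrs G y"
        then have "v \<in> non_nbrs G y" using v vV by (simp add: non_nbrs_def)
        moreover have "x = y \<or> x \<in> non_nbrs G y"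
          using False x pair_graphD(4)[OF G] by (auto simp: non_nbrs_def nbrs_def swing_def)
        ultimately have "(x, v) \<notin> parcs G \<or> x = y"
          using y by (auto simp: swing_def is_stable_def)
        then show False using v \<open>v \<notin> nbrs G y\<close> by (auto simp: nbrs_def)
      qed
    qed
  qed
  from this[OF x y] this[OF y x] show ?thesis
    using pair_graphD(5)[OF G] by (auto simp: nbrs_def)
qed

lemma swing_automorphism:
  assumes G: "pair_graph G" and x: "swing G x" and y: "swing G y"
  shows "is_graph_iso (Transposition.transpose x y) G G"
proof -
  have V: "x \<in> pverts G" "y \<in> pverts G" using x y by (auto simp: swing_def)
  \<comment> \<open>Only arcs between \<open>x\<close> or \<open>y\<close> and a third vertex are
    really moved by the transposition, and these are matched by the twin property. A possible arc
    between \<open>x\<close> and \<open>y\<close> is reversed, which symmetry allows.\<close>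
  have tw: "(x, v) \<in> parcs G \<longleftrightarrow> (y, v) \<in> parcs G" if "v \<noteq> x" "v \<noteq> y" for v
    using swing_twins[OF G x y] that by (auto simp: nbrs_def)
  have G': "(u, v) \<in> parcs G \<longleftrightarrow> (v, u) \<in> parcs G" "(u, u) \<notin> parcs G" for u v
    using pair_graphD(4,5)[OF G] by blast+
  have "bij_betw (Transposition.transpose x y) (pverts G) (pverts G)"
    using V by (simp add: bij_betw_transpose_iff)
  moreover have "(u, v) \<in> parcs G \<longleftrightarrow>
      (Transposition.transpose x y u, Transposition.transpose x y v) \<in> parcs G" for u v
    by (cases "u = x"; cases "u = y"; cases "v = x"; cases "v = y") (simp_all, (metis tw G')+)
  ultimately show ?thesis by (simp add: is_graph_iso_def)
qed

text \<open>The vertex \<open>f x\<close> is swing in \<open>H\<close>, so composing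
  \<open>f\<close> with the transposition of \<open>f x\<close> and \<open>y\<close> corrects its
  value at \<open>x\<close>. This makes the choice of swing vertex irrelevant up to
  isomorphism.\<close>

lemma swing_iso:
  assumes G: "pair_graph G" and H: "pair_graph H" and x: "swing G x" and y: "swing H y"
    and f: "is_graph_iso f G H"
  obtains g where "is_graph_iso g G H" "g x = y"
proof
  have fx: "swing H (f x)" by (rule swing_image[OF G H f x])
  show "is_graph_iso (Transposition.transpose (f x) y \<circ> f) G H"
    by (rule is_graph_iso_comp[OF f swing_automorphism[OF H fx y]])
  show "(Transposition.transpose (f x) y \<circ> f) x = y" by simp
qed

section \<open>Swing vertices and maximal partitions\<close>

lemma is_clique_subset: "is_clique G K \<Longrightarrow> L \<subseteq> K \<Longrightarrow> is_clique G L"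
  and is_stable_subset: "is_stable G S \<Longrightarrow> T \<subseteq> S \<Longrightarrow> is_stable G T"
  by (auto simp: is_clique_def is_stable_def subset_iff)

lemma is_clique_insert:
  assumes "pair_graph G" "x \<in> pverts G" "is_clique G K"
    and "\<And>k. k \<in> K \<Longrightarrow> k \<noteq> x \<Longrightarrow> (x, k) \<in> parcs G"
  shows "is_clique G (insert x K)"
  unfolding is_clique_def
proof (intro conjI ballI impI)
  show "insert x K \<subseteq> pverts G" using assms by (simp add: is_clique_def)
  fix u v assume "u \<in> insert x K" "v \<in> insert x K" "u \<noteq> v"
  then consider "u = x" "v \<in> K" "v \<noteq> x" | "v = x" "u \<in> K" "u \<noteq> x" | "u \<in> K" "v \<in> K" "u \<noteq> v"
    by blast
  then show "(u, v) \<in> parcs G"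
    using assms(3,4) pair_graphD(4)[OF assms(1), of x u]
    by cases (simp_all add: is_clique_def)
qed

lemma is_stable_insert:
  assumes "pair_graph G" "x \<in> pverts G" "is_stable G S"
    and "\<And>s. s \<in> S \<Longrightarrow> (x, s) \<notin> parcs G"
  shows "is_stable G (insert x S)"
  unfolding is_stable_def
proof (intro conjI ballI)
  show "insert x S \<subseteq> pverts G" using assms by (simp add: is_stable_def)
  fix u v assume "u \<in> insert x S" "v \<in> insert x S"
  then consider "u = x" "v = x" | "u = x" "v \<in> S" | "v = x" "u \<in> S" | "u \<in> S" "v \<in> S"
    by blast
  then show "(u, v) \<notin> parcs G"
    using assms(3,4) pair_graphD(4)[OF assms(1), of u x] pair_graphD(5)[OF assms(1)]
    by cases (auto simp: is_stable_def)
qed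

lemma clique_stable_inter:
  "is_clique G K \<Longrightarrow> is_stable G S \<Longrightarrow> u \<in> K \<Longrightarrow> u \<in> S \<Longrightarrow> v \<in> K \<Longrightarrow> v \<in> S \<Longrightarrow> u = v"
  unfolding is_clique_def is_stable_def by blast

section \<open>Extremal cliques and stable sets relative to a KS-partition\<close>

lemma finite_card_cliques: "finite (pverts G) \<Longrightarrow> finite (card ` {K. is_clique G K})"
  and finite_card_stables: "finite (pverts G) \<Longrightarrow> finite (card ` {S. is_stable G S})"
proof -
  assume "finite (pverts G)"
  then have "finite (Pow (pverts G))" by simp
  moreover have "{K. is_clique G K} \<subseteq> Pow (pverts G)" "{S. is_stable G S} \<subseteq> Pow (pverts G)"
    by (auto simp: is_clique_def is_stable_def)
  ultimately show "finite (card ` {K. is_clique G K})" "finite (card ` {S. is_stable G S})"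
    by (meson finite_imageI finite_subset)+
qed

lemma clique_number_ge: "finite (pverts G) \<Longrightarrow> is_clique G K \<Longrightarrow> card K \<le> clique_number G"
  and independence_number_ge:
    "finite (pverts G) \<Longrightarrow> is_stable G S \<Longrightarrow> card S \<le> independence_number G"
  using finite_card_cliques[of G] finite_card_stables[of G]
  by (auto simp: clique_number_def independence_number_def intro!: Max_ge)

lemma clique_number_attained:
  assumes "finite (pverts G)"
  obtains K where "is_clique G K" "card K = clique_number G"
proof -
  have "is_clique G {}" by (simp add: is_clique_def)
  then have "clique_number G \<in> card ` {K. is_clique G K}"
    unfolding clique_number_def by (intro Max_in finite_card_cliques[OF assms]) auto
  then show ?thesis using that by auto
qed

lemma independence_number_attained:
  assumes "finite (pverts G)"
  obtains S where "is_stable G S" "card S = independence_number G"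
proof -
  have "is_stable G {}" by (simp add: is_stable_def)
  then have "independence_number G \<in> card ` {S. is_stable G S}"
    unfolding independence_number_def by (intro Max_in finite_card_stables[OF assms]) auto
  then show ?thesis using that by auto
qed

text \<open>A clique meets the stable side \<open>S\<close> in at most one vertex \<open>s\<close>,
  so \<open>C\<close> is contained in \<open>insert s K\<close>; the cardinalities then force
  equality.\<close>

lemma larger_clique:
  assumes G: "finite (pverts G)" and p: "KS_partition G K S" and C: "is_clique G C"
    and lt: "card K < card C"
  obtains s where "s \<in> S" "C = insert s K"
proof -
  have fin: "finite C" "finite K"
    using G C p by (auto simp: is_clique_def KS_partition_def intro: finite_subset)
  have "\<not> C \<subseteq> K" using lt fin card_mono leD by blast
  then obtain s where s: "s \<in> C" "s \<notin> K" by blast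
  have sS: "s \<in> S" using s C p by (auto simp: KS_partition_def is_clique_def)
  have "C \<subseteq> insert s K"
  proof
    fix v assume v: "v \<in> C"
    then have "v \<in> K \<or> v \<in> S" using C p by (auto simp: KS_partition_def is_clique_def)
    then show "v \<in> insert s K"
      using clique_stable_inter[OF C, of S s v] p s sS v by (auto simp: KS_partition_def)
  qed
  moreover have "card (insert s K) \<le> card C"
    using lt fin s by simp
  ultimately have "C = insert s K"
    using fin by (intro card_seteq) auto
  then show ?thesis using that sS by blast
qed

text \<open>Dual to \<open>larger_clique\<close>: a stable set meets the clique side in at most one
  vertex.\<close>

lemma larger_stable:
  assumes G: "finite (pverts G)" and p: "KS_partition G K S" and C: "is_stable G T"
    and lt: "card S < card T"
  obtains k where "k \<in> K" "T = insert k S"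
proof -
  have fin: "finite T" "finite S"
    using G C p by (auto simp: is_stable_def KS_partition_def intro: finite_subset)
  have "\<not> T \<subseteq> S" using lt fin card_mono leD by blast
  then obtain k where k: "k \<in> T" "k \<notin> S" by blast
  have kK: "k \<in> K" using k C p by (auto simp: KS_partition_def is_stable_def)
  have "T \<subseteq> insert k S"
  proof
    fix v assume v: "v \<in> T"
    then have "v \<in> K \<or> v \<in> S" using C p by (auto simp: KS_partition_def is_stable_def)
    then show "v \<in> insert k S"
      using clique_stable_inter[OF _ C, of K k v] p k kK v by (auto simp: KS_partition_def)
  qed
  moreover have "card (insert k S) \<le> card T"
    using lt fin k by simp
  ultimately have "T = insert k S"
    using fin by (intro card_seteq) auto
  then show ?thesis using that kK by blast
qed

text \<open>A swing vertex is adjacent to all of \<open>nbrs G x\<close> and to none of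
  \<open>non_nbrs G x\<close>, so it may join either side.\<close>

lemma swing_partitions:
  assumes G: "pair_graph G" and x: "swing G x"
  shows "KS_partition G (insert x (nbrs G x)) (non_nbrs G x)"
    and "KS_partition G (nbrs G x) (insert x (non_nbrs G x))"
proof -
  have "x \<in> pverts G" "x \<notin> nbrs G x" "nbrs G x \<subseteq> pverts G"
    using x pair_graphD[OF G] by (auto simp: swing_def nbrs_def)
  moreover have "is_clique G (insert x (nbrs G x))"
    using x by (intro is_clique_insert[OF G]) (auto simp: swing_def nbrs_def)
  moreover have "is_stable G (insert x (non_nbrs G x))"
    using x by (intro is_stable_insert[OF G]) (auto simp: swing_def nbrs_def non_nbrs_def)
  ultimately show "KS_partition G (insert x (nbrs G x)) (non_nbrs G x)"
    "KS_partition G (nbrs G x) (insert x (non_nbrs G x))"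
    using x by (auto simp: KS_partition_def swing_def non_nbrs_def)
qed

text \<open>Converse of \<open>swing_partitions\<close>. Membership in the clique makes
  \<open>x\<close> adjacent to all of \<open>K\<close>, membership in the stable set makes it
  adjacent to nothing in \<open>S\<close>, and these two sets exhaust the other vertices.\<close>

lemma swingI:
  assumes G: "pair_graph G" and x: "x \<notin> K" "x \<notin> S"
    and p: "KS_partition G (insert x K) S" "KS_partition G K (insert x S)"
  shows "swing G x" "nbrs G x = K" "non_nbrs G x = S"
proof -
  show K: "nbrs G x = K"
    using p x pair_graphD(3,5)[OF G]
    by (fastforce simp: KS_partition_def is_clique_def is_stable_def nbrs_def)
  then show S: "non_nbrs G x = S"
    using p x by (auto simp: KS_partition_def non_nbrs_def)
  show "swing G x"
    using K S p by (auto simp: swing_def KS_partition_def)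
qed

text \<open>The lower bound is the clique \<open>insert x (nbrs G x)\<close>. For the upper bound,
  \<open>larger_clique\<close> is applied to the partition with \<open>x\<close> on the stable side:
  a clique larger than \<open>nbrs G x\<close> exceeds it by exactly one vertex.\<close>

lemma swing_clique_number:
  assumes G: "pair_graph G" and x: "swing G x"
  shows "clique_number G = Suc (card (nbrs G x))"
proof -
  have fin: "finite (pverts G)" "finite (nbrs G x)" "x \<notin> nbrs G x"
    using G pair_graphD[OF G] by (auto simp: nbrs_def intro: finite_subset[of _ "pverts G"])
  obtain C where C: "is_clique G C" "card C = clique_number G"
    using clique_number_attained[OF fin(1)] .
  have "card C \<le> Suc (card (nbrs G x))"
  proof (rule ccontr)
    assume gt: "\<not> card C \<le> Suc (card (nbrs G x))"
    then have "card (nbrs G x) < card C" by simp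
    from larger_clique[OF fin(1) swing_partitions(2)[OF G x] C(1) this]
    obtain s where "C = insert s (nbrs G x)" by blast
    then show False using gt fin(2) by (simp add: card_insert_if split: if_splits)
  qed
  moreover have "Suc (card (nbrs G x)) \<le> clique_number G"
    using clique_number_ge[OF fin(1), of "insert x (nbrs G x)"] swing_partitions(1)[OF G x] fin
    by (simp add: KS_partition_def)
  ultimately show ?thesis using C by simp
qed

lemma swing_independence_number:
  assumes G: "pair_graph G" and x: "swing G x"
  shows "independence_number G = Suc (card (non_nbrs G x))"
proof -
  have fin: "finite (pverts G)" "finite (non_nbrs G x)" "x \<notin> non_nbrs G x"
    using G pair_graphD[OF G] by (auto simp: non_nbrs_def)
  obtain T where T: "is_stable G T" "card T = independence_number G"
    using independence_number_attained[OF fin(1)] .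
  have "card T \<le> Suc (card (non_nbrs G x))"
  proof (rule ccontr)
    assume gt: "\<not> card T \<le> Suc (card (non_nbrs G x))"
    then have "card (non_nbrs G x) < card T" by simp
    from larger_stable[OF fin(1) swing_partitions(1)[OF G x] T(1) this]
    obtain k where "T = insert k (non_nbrs G x)" by blast
    then show False using gt fin(2) by (simp add: card_insert_if split: if_splits)
  qed
  moreover have "Suc (card (non_nbrs G x)) \<le> independence_number G"
    using independence_number_ge[OF fin(1), of "insert x (non_nbrs G x)"]
      swing_partitions(2)[OF G x] fin
    by (simp add: KS_partition_def)
  ultimately show ?thesis using T by simp
qed

section \<open>Swing vertices characterize unbalanced graphs and their maximal partitions\<close>

lemma KS_partition_card:
  "finite (pverts G) \<Longrightarrow> KS_partition G K S \<Longrightarrow> card K + card S = card (pverts G)"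
  unfolding KS_partition_def by (metis card_Un_disjoint finite_Un)

text \<open>With a swing vertex the clique and independence numbers add up to one more than the
  number of vertices, whereas the two sides of any KS-partition add up to exactly that
  number.\<close>

lemma swing_unbalanced:
  assumes G: "pair_graph G" and x: "swing G x"
  shows "unbalanced_split_graph G"
proof -
  have fin: "finite (pverts G)" "finite (nbrs G x)" "x \<notin> nbrs G x"
    using G pair_graphD[OF G] by (auto simp: nbrs_def intro: finite_subset[of _ "pverts G"])
  have "\<not> balanced_split_graph G"
  proof
    assume "balanced_split_graph G"
    then obtain K S where "KS_partition G K S" "card K = clique_number G"
      "card S = independence_number G"
      by (auto simp: balanced_split_graph_def K_max_partition_def S_max_partition_def)
    then show False
      using KS_partition_card[OF fin(1), of K S]
        KS_partition_card[OF fin(1) swing_partitions(1)[OF G x]] fin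
        swing_clique_number[OF G x] swing_independence_number[OF G x]
      by simp
  qed
  then show ?thesis
    using G swing_partitions(1)[OF G x]
    by (auto simp: unbalanced_split_graph_def split_graph_def)
qed

text \<open>A maximum stable set is larger than \<open>S\<close>, hence of the form
  \<open>insert x S\<close> with \<open>x\<close> in \<open>K\<close>. So \<open>x\<close> can
  change sides, which makes it swing.\<close>

lemma not_S_max_swing:
  assumes G: "pair_graph G" and p: "KS_partition G K S" and "\<not> S_max_partition G K S"
  obtains x where "swing G x" "K = insert x (nbrs G x)" "S = non_nbrs G x"
proof -
  have fin: "finite (pverts G)" using pair_graphD(1)[OF G] .
  have S: "is_stable G S" using p by (simp add: KS_partition_def)
  obtain T where T: "is_stable G T" "card T = independence_number G"
    using independence_number_attained[OF fin] .
  have "card S < card T"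
    using assms(3) p T independence_number_ge[OF fin S] by (auto simp: S_max_partition_def)
  from larger_stable[OF fin p T(1) this] obtain x where x: "x \<in> K" "T = insert x S" by blast
  have "KS_partition G (insert x (K - {x})) S" "KS_partition G (K - {x}) (insert x S)" "x \<notin> S"
    using p x T by (auto simp: KS_partition_def insert_absorb intro: is_clique_subset)
  then show ?thesis
    using swingI[OF G, of x "K - {x}" S] x that[of x] by (auto simp: insert_absorb)
qed

lemma not_K_max_swing:
  assumes G: "pair_graph G" and p: "KS_partition G K S" and "\<not> K_max_partition G K S"
  obtains x where "swing G x" "K = nbrs G x" "S = insert x (non_nbrs G x)"
proof -
  have fin: "finite (pverts G)" using pair_graphD(1)[OF G] .
  have K: "is_clique G K" using p by (simp add: KS_partition_def)
  obtain C where C: "is_clique G C" "card C = clique_number G"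
    using clique_number_attained[OF fin] .
  have "card K < card C"
    using assms(3) p C clique_number_ge[OF fin K] by (auto simp: K_max_partition_def)
  from larger_clique[OF fin p C(1) this] obtain x where x: "x \<in> S" "C = insert x K" by blast
  have "KS_partition G (insert x K) (S - {x})" "KS_partition G K (insert x (S - {x}))" "x \<notin> K"
    using p x C by (auto simp: KS_partition_def insert_absorb intro: is_stable_subset)
  then show ?thesis
    using swingI[OF G, of x K "S - {x}"] x that[of x] by (auto simp: insert_absorb)
qed

lemma unbalanced_iff_swing:
  "unbalanced_split_graph G \<longleftrightarrow> pair_graph G \<and> (\<exists>x. swing G x)"
proof
  assume u: "unbalanced_split_graph G"
  then obtain K S where G: "pair_graph G" and p: "KS_partition G K S"
    by (auto simp: unbalanced_split_graph_def split_graph_def)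
  have "\<not> K_max_partition G K S \<or> \<not> S_max_partition G K S"
    using u by (auto simp: unbalanced_split_graph_def balanced_split_graph_def)
  then show "pair_graph G \<and> (\<exists>x. swing G x)"
    using not_K_max_swing[OF G p] not_S_max_swing[OF G p] G by metis
qed (auto intro: swing_unbalanced)

text \<open>In an unbalanced graph a \<open>K\<close>-max partition cannot be \<open>S\<close>-max,
  and the failure of \<open>S\<close>-maximality exhibits a swing vertex on the clique side. The
  converse reads off the clique number.\<close>

lemma unbalanced_K_max_iff:
  "unbalanced_split_graph G \<and> K_max_partition G K S \<longleftrightarrow>
     pair_graph G \<and> (\<exists>x. swing G x \<and> K = insert x (nbrs G x) \<and> S = non_nbrs G x)"
proof
  assume u: "unbalanced_split_graph G \<and> K_max_partition G K S"
  then have "pair_graph G" "KS_partition G K S" "\<not> S_max_partition G K S"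
    by (auto simp: unbalanced_split_graph_def split_graph_def balanced_split_graph_def
        K_max_partition_def)
  then show "pair_graph G \<and> (\<exists>x. swing G x \<and> K = insert x (nbrs G x) \<and> S = non_nbrs G x)"
    using not_S_max_swing by metis
next
  assume "pair_graph G \<and> (\<exists>x. swing G x \<and> K = insert x (nbrs G x) \<and> S = non_nbrs G x)"
  then obtain x where G: "pair_graph G" and x: "swing G x" "K = insert x (nbrs G x)" "S = non_nbrs G x"
    by blast
  have "finite (nbrs G x)" "x \<notin> nbrs G x"
    using pair_graphD[OF G] by (auto simp: nbrs_def intro: finite_subset[of _ "pverts G"])
  then have "K_max_partition G K S"
    using swing_partitions(1)[OF G x(1)] swing_clique_number[OF G x(1)] x
    by (simp add: K_max_partition_def)
  then show "unbalanced_split_graph G \<and> K_max_partition G K S"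
    using swing_unbalanced[OF G x(1)] by blast
qed

lemma unbalanced_S_max_iff:
  "unbalanced_split_graph G \<and> S_max_partition G K S \<longleftrightarrow>
     pair_graph G \<and> (\<exists>x. swing G x \<and> K = nbrs G x \<and> S = insert x (non_nbrs G x))"
proof
  assume u: "unbalanced_split_graph G \<and> S_max_partition G K S"
  then have "pair_graph G" "KS_partition G K S" "\<not> K_max_partition G K S"
    by (auto simp: unbalanced_split_graph_def split_graph_def balanced_split_graph_def
        S_max_partition_def)
  then show "pair_graph G \<and> (\<exists>x. swing G x \<and> K = nbrs G x \<and> S = insert x (non_nbrs G x))"
    using not_K_max_swing by metis
next
  assume "pair_graph G \<and> (\<exists>x. swing G x \<and> K = nbrs G x \<and> S = insert x (non_nbrs G x))"
  then obtain x where G: "pair_graph G" and x: "swing G x" "K = nbrs G x" "S = insert x (non_nbrs G x)"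
    by blast
  have "finite (non_nbrs G x)" "x \<notin> non_nbrs G x"
    using pair_graphD[OF G] by (auto simp: non_nbrs_def)
  then have "S_max_partition G K S"
    using swing_partitions(2)[OF G x(1)] swing_independence_number[OF G x(1)] x
    by (simp add: S_max_partition_def)
  then show "unbalanced_split_graph G \<and> S_max_partition G K S"
    using swing_unbalanced[OF G x(1)] by blast
qed

text \<open>In an unbalanced graph, a partition that is not \<open>K\<close>-max arises from a swing
  vertex on the stable side and is therefore \<open>S\<close>-max. Thus the three families of
  triples cover all KS-partitioned graphs.\<close>

lemma KS_partition_cases:
  assumes "pair_graph G" "KS_partition G K S"
  shows "unbalanced_split_graph G \<and> K_max_partition G K S \<or>
    unbalanced_split_graph G \<and> S_max_partition G K S \<or> balanced_split_graph G"
proof (rule ccontr)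
  assume c: "\<not> ?thesis"
  then have u: "unbalanced_split_graph G"
    using assms by (auto simp: unbalanced_split_graph_def split_graph_def)
  with c have "\<not> K_max_partition G K S" by blast
  then obtain x where "swing G x" "K = nbrs G x" "S = insert x (non_nbrs G x)"
    using not_K_max_swing assms by metis
  then show False using c unbalanced_S_max_iff[of G K S] assms by blast
qed

text \<open>Two different partitions would have clique sides of equal size that differ by exchanging
  one vertex \<open>y\<close> for one vertex \<open>s\<close>. If \<open>y\<close> and
  \<open>s\<close> are adjacent, \<open>insert s K\<close> is too large a clique; otherwise
  \<open>insert y S\<close> is too large a stable set.\<close>

lemma balanced_partition_unique:
  assumes b: "balanced_split_graph G" and p: "KS_partition G K S" and q: "KS_partition G L T"
  shows "K = L"
proof (rule ccontr)
  assume "K \<noteq> L"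
  have G: "pair_graph G" using b by (simp add: balanced_split_graph_def split_graph_def)
  have fin: "finite (pverts G)" using pair_graphD(1)[OF G] .
  have noswing: "\<not> swing G x" for x
    using swing_unbalanced[OF G] b by (auto simp: unbalanced_split_graph_def)
  \<comment> \<open>Without swing vertices every KS-partition is both \<open>K\<close>-max and
    \<open>S\<close>-max.\<close>
  have card: "card K = clique_number G" "card L = clique_number G" "card S = independence_number G"
    using not_K_max_swing[OF G p] not_K_max_swing[OF G q] not_S_max_swing[OF G p] noswing
    by (auto simp: K_max_partition_def S_max_partition_def)
  have KL: "finite K" "finite L" "finite S"
    using fin p q by (auto simp: KS_partition_def intro: finite_subset)
  have KS: "is_clique G K" "is_stable G S" "is_clique G L" "is_stable G T"
    "K \<union> S = pverts G" "L \<union> T = pverts G" "K \<inter> S = {}" "L \<inter> T = {}"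
    using p q by (auto simp: KS_partition_def)
  have "\<not> K \<subseteq> L" "\<not> L \<subseteq> K"
    using card KL \<open>K \<noteq> L\<close> by (metis card_subset_eq)+
  then obtain y s where ys: "y \<in> K" "y \<notin> L" "s \<in> L" "s \<notin> K" by blast
  have "y \<in> T" "s \<in> S" using ys KS by blast+
  \<comment> \<open>The clique \<open>K\<close> meets the stable set \<open>T\<close> only in
    \<open>y\<close>, and the clique \<open>L\<close> meets the stable set \<open>S\<close> only in
    \<open>s\<close>.\<close>
  have K: "k \<in> L" if "k \<in> K" "k \<noteq> y" for k
    using clique_stable_inter[OF KS(1,4), of k y] that ys \<open>y \<in> T\<close> KS(5,6) by blast
  have S: "t \<in> T" if "t \<in> S" "t \<noteq> s" for t
    using clique_stable_inter[OF KS(3,2), of t s] that ys \<open>s \<in> S\<close> KS(5,6) by blast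
  show False
  proof (cases "(y, s) \<in> parcs G")
    case True
    have "is_clique G (insert s K)"
    proof (intro is_clique_insert[OF G] KS(1))
      show "s \<in> pverts G" using ys KS by blast
      fix k assume "k \<in> K" "k \<noteq> s"
      then show "(s, k) \<in> parcs G"
        using K[of k] ys KS(3) pair_graphD(4)[OF G True] by (cases "k = y") (auto simp: is_clique_def)
    qed
    then show False using clique_number_ge[OF fin, of "insert s K"] card KL ys by simp
  next
    case False
    have "is_stable G (insert y S)"
    proof (intro is_stable_insert[OF G] KS(2))
      show "y \<in> pverts G" using ys KS by blast
      fix t assume "t \<in> S"
      then show "(y, t) \<notin> parcs G"
        using S[of t] \<open>y \<in> T\<close> KS(4) False by (cases "t = s") (auto simp: is_stable_def)
    qed
    moreover have "y \<notin> S" using ys KS by blast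
    ultimately show False using independence_number_ge[OF fin, of "insert y S"] card KL by simp
  qed
qed

section \<open>Deleting a swing vertex\<close>

text \<open>The recorded partition is what is needed to undo the deletion: \<open>x\<close> has to
  be joined again to the clique side and to nothing else.\<close>

definition swing_triple :: "'a pair_pre_digraph \<Rightarrow> 'a \<Rightarrow> 'a KS_triple" where
  "swing_triple G x = (delete_vertex G x, nbrs G x, non_nbrs G x)"

lemma is_graph_iso_delete:
  assumes "is_graph_iso g G H" "x \<in> pverts G"
  shows "is_graph_iso g (delete_vertex G x) (delete_vertex H (g x))"
proof -
  have inj: "g u = g x \<longleftrightarrow> u = x" if "u \<in> pverts G" for u
    using that assms(2) is_graph_iso_inj[OF assms(1)] by (auto simp: inj_on_def)
  have "bij_betw g (pverts G - {x}) (pverts H - {g x})"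
    using assms by (intro bij_betw_DiffI) (auto simp: is_graph_iso_def dest: bij_betwE)
  then show ?thesis
    using inj is_graph_iso_arcs[OF assms(1)] by (simp add: is_graph_iso_def)
qed

lemma KS_partition_delete_swing:
  assumes "pair_graph G" "swing G x"
  shows "KS_partition (delete_vertex G x) (nbrs G x) (non_nbrs G x)"
proof -
  have "x \<in> pverts G" "x \<notin> nbrs G x" "x \<notin> non_nbrs G x" "nbrs G x \<subseteq> pverts G"
    using assms(2) pair_graphD[OF assms(1)] by (auto simp: swing_def nbrs_def non_nbrs_def)
  then show ?thesis
    using assms(2)
    by (auto simp: KS_partition_def swing_def non_nbrs_def is_clique_def is_stable_def)
qed

text \<open>An isomorphism of the graphs can be chosen to send \<open>x\<close> to \<open>y\<close>
  and then restricts to the remaining vertices. Conversely, an isomorphism of the triples carries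
  neighbours of \<open>x\<close> to neighbours of \<open>y\<close>, so it extends by sending
  \<open>x\<close> to \<open>y\<close>.\<close>

lemma swing_triple_iso_iff:
  assumes G: "pair_graph G" and H: "pair_graph H" and x: "swing G x" and y: "swing H y"
  shows "(swing_triple G x, swing_triple H y) \<in> triple_iso_rel \<longleftrightarrow> (G, H) \<in> graph_iso_rel"
proof
  have V: "x \<in> pverts G" "y \<in> pverts H" using x y by (auto simp: swing_def)
  {
    assume "(G, H) \<in> graph_iso_rel"
    then obtain f where f: "is_graph_iso f G H" by (auto simp: graph_iso_rel_def)
    obtain g where g: "is_graph_iso g G H" "g x = y"
      using swing_iso[OF G H x y f] .
    then show "(swing_triple G x, swing_triple H y) \<in> triple_iso_rel"
      using is_graph_iso_delete[OF g(1) V(1)] nbrs_image[OF G H g(1) V(1)]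
        non_nbrs_image[OF G H g(1) V(1)] pair_graph_delete_vertex[OF G]
        pair_graph_delete_vertex[OF H] KS_partition_delete_swing[OF G x]
        KS_partition_delete_swing[OF H y]
      unfolding triple_iso_rel_def swing_triple_def by auto
  }
  assume "(swing_triple G x, swing_triple H y) \<in> triple_iso_rel"
  then obtain f where f: "is_graph_iso f (delete_vertex G x) (delete_vertex H y)"
    and N: "f ` nbrs G x = nbrs H y"
    by (auto simp: triple_iso_rel_def swing_triple_def)
  \<comment> \<open>The value of \<open>f\<close> at the deleted vertex \<open>x\<close> is
    arbitrary and has to be overwritten.\<close>
  let ?g = "f(x := y)"
  have bij: "bij_betw f (pverts G - {x}) (pverts H - {y})"
    using f by (simp add: is_graph_iso_def)
  have "bij_betw ?g (pverts G - {x}) (pverts H - {y})"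
    using bij by (rule bij_betw_cong[THEN iffD1, rotated]) simp
  moreover have "bij_betw ?g {x} {y}" by (simp add: bij_betw_def)
  ultimately have "bij_betw ?g ((pverts G - {x}) \<union> {x}) ((pverts H - {y}) \<union> {y})"
    by (rule bij_betw_combine) blast
  then have "bij_betw ?g (pverts G) (pverts H)"
    using V by (simp add: insert_absorb)
  moreover have "(u, v) \<in> parcs G \<longleftrightarrow> (?g u, ?g v) \<in> parcs H"
    if uv: "u \<in> pverts G" "v \<in> pverts G" for u v
  proof -
    have fne: "f w \<noteq> y" if "w \<in> pverts G" "w \<noteq> x" for w
      using bij_betwE[OF bij] that by blast
    \<comment> \<open>The arcs at \<open>x\<close> are not seen by the deleted graphs; they are
      recovered from \<open>N\<close>, where injectivity of \<open>f\<close> away from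
      \<open>x\<close> turns the equality of images into an equivalence.\<close>
    have N': "(x, w) \<in> parcs G \<longleftrightarrow> (y, f w) \<in> parcs H" if w: "w \<in> pverts G" "w \<noteq> x" for w
    proof -
      have "nbrs G x \<subseteq> pverts G - {x}"
        using pair_graphD(3,5)[OF G] by (auto simp: nbrs_def)
      then have "f w \<in> f ` nbrs G x \<longleftrightarrow> w \<in> nbrs G x"
        using w bij by (intro inj_on_image_mem_iff[of f "pverts G - {x}"]) (auto simp: bij_betw_def)
      then show ?thesis by (simp add: N) (simp add: nbrs_def)
    qed
    have comm: "(a, b) \<in> parcs G \<longleftrightarrow> (b, a) \<in> parcs G" "(c, d) \<in> parcs H \<longleftrightarrow> (d, c) \<in> parcs H"
      for a b c d
      using pair_graphD(4)[OF G] pair_graphD(4)[OF H] by blast+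
    consider "u = x" "v = x" | "u = x" "v \<noteq> x" | "u \<noteq> x" "v = x" | "u \<noteq> x" "v \<noteq> x" by blast
    then show ?thesis
    proof cases
      case 1
      then show ?thesis using pair_graphD(5)[OF G] pair_graphD(5)[OF H] by simp
    next
      case 2
      then show ?thesis using N' uv by simp
    next
      case 3
      then show ?thesis using N'[of u] uv comm(1)[of u x] comm(2)[of "f u" y] by simp
    next
      case 4
      then show ?thesis using is_graph_iso_arcs[OF f, of u v] uv fne by simp
    qed
  qed
  ultimately have "is_graph_iso ?g G H" by (simp add: is_graph_iso_def)
  then show "(G, H) \<in> graph_iso_rel" by (rule graph_iso_relI[OF G H])
qed

text \<open>An unbalanced graph has only one \<open>K\<close>-max partition up to isomorphism: an
  isomorphism sending \<open>x\<close> to \<open>y\<close> carries one partition to the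
  other.\<close>

lemma swing_K_max_iso_iff:
  assumes G: "pair_graph G" and H: "pair_graph H" and x: "swing G x" and y: "swing H y"
  shows "((G, insert x (nbrs G x), non_nbrs G x), (H, insert y (nbrs H y), non_nbrs H y))
    \<in> triple_iso_rel \<longleftrightarrow> (G, H) \<in> graph_iso_rel"
proof
  have V: "x \<in> pverts G" using x by (simp add: swing_def)
  assume "(G, H) \<in> graph_iso_rel"
  then obtain f where f: "is_graph_iso f G H" by (auto simp: graph_iso_rel_def)
  obtain g where g: "is_graph_iso g G H" "g x = y"
    using swing_iso[OF G H x y f] .
  then show "((G, insert x (nbrs G x), non_nbrs G x), (H, insert y (nbrs H y), non_nbrs H y))
    \<in> triple_iso_rel"
    using nbrs_image[OF G H g(1) V] non_nbrs_image[OF G H g(1) V]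
    by (intro triple_iso_relI[OF G swing_partitions(1)[OF G x] H swing_partitions(1)[OF H y] g(1)])
      simp_all
qed (auto simp: triple_iso_rel_def graph_iso_rel_def)

lemma swing_S_max_iso_iff:
  assumes G: "pair_graph G" and H: "pair_graph H" and x: "swing G x" and y: "swing H y"
  shows "((G, nbrs G x, insert x (non_nbrs G x)), (H, nbrs H y, insert y (non_nbrs H y)))
    \<in> triple_iso_rel \<longleftrightarrow> (G, H) \<in> graph_iso_rel"
proof
  have V: "x \<in> pverts G" using x by (simp add: swing_def)
  assume "(G, H) \<in> graph_iso_rel"
  then obtain f where f: "is_graph_iso f G H" by (auto simp: graph_iso_rel_def)
  obtain g where g: "is_graph_iso g G H" "g x = y"
    using swing_iso[OF G H x y f] .
  then show "((G, nbrs G x, insert x (non_nbrs G x)), (H, nbrs H y, insert y (non_nbrs H y)))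
    \<in> triple_iso_rel"
    using nbrs_image[OF G H g(1) V] non_nbrs_image[OF G H g(1) V]
    by (intro triple_iso_relI[OF G swing_partitions(2)[OF G x] H swing_partitions(2)[OF H y] g(1)])
      simp_all
qed (auto simp: triple_iso_rel_def graph_iso_rel_def)

text \<open>Inverse of deletion: a fresh vertex \<open>x\<close> is joined to exactly the vertices
  of \<open>K\<close>, so that \<open>K\<close> and \<open>S\<close> become its neighbours and
  non-neighbours. The infinite type supplies the fresh vertex.\<close>

lemma swing_extension:
  fixes G :: "'a pair_pre_digraph"
  assumes inf: "infinite (UNIV :: 'a set)" and G: "pair_graph G" and p: "KS_partition G K S"
  obtains H x where "pair_graph H" "swing H x" "swing_triple H x = (G, K, S)"
proof -
  obtain x where x: "x \<notin> pverts G"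
    using ex_new_if_finite[OF inf pair_graphD(1)[OF G]] by blast
  let ?H = "\<lparr>pverts = insert x (pverts G), parcs = parcs G \<union> {x} \<times> K \<union> K \<times> {x}\<rparr>"
  have KS: "K \<subseteq> pverts G" "S \<subseteq> pverts G" "x \<notin> K" "x \<notin> S" "K \<union> S = pverts G" "K \<inter> S = {}"
    using p x by (auto simp: KS_partition_def)
  have arcs: "(u, v) \<in> parcs G \<Longrightarrow> u \<noteq> x \<and> v \<noteq> x" for u v
    using pair_graphD(2,3)[OF G] x by blast
  have H: "pair_graph ?H"
    using G KS by (auto simp: pair_graph_iff sym_def)
  have N: "nbrs ?H x = K" using arcs by (auto simp: nbrs_def)
  have M: "non_nbrs ?H x = S" using N KS by (auto simp: non_nbrs_def)
  have "is_clique ?H K" "is_stable ?H S"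
    using p KS by (auto simp: KS_partition_def is_clique_def is_stable_def)
  then have "swing ?H x" using N M by (simp add: swing_def)
  moreover have "delete_vertex ?H x = G"
    using x arcs KS by (auto simp: delete_vertex_def intro!: pair_pre_digraph.equality)
  ultimately show ?thesis using that H N M by (auto simp: swing_triple_def)
qed

section \<open>Counting\<close>

lemma unbalanced_iso:
  assumes "(G, H) \<in> graph_iso_rel" "unbalanced_split_graph G"
  shows "unbalanced_split_graph H"
proof -
  obtain f x where "pair_graph G" "pair_graph H" "is_graph_iso f G H" "swing G x"
    using assms by (auto simp: graph_iso_rel_def unbalanced_iff_swing)
  then show ?thesis using swing_image swing_unbalanced by metis
qed

lemma pair_graph_unbalanced: "unbalanced_split_graph G \<Longrightarrow> pair_graph G"
  and pair_graph_balanced: "balanced_split_graph G \<Longrightarrow> pair_graph G"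
  by (simp_all add: unbalanced_split_graph_def balanced_split_graph_def split_graph_def)

lemma KS_partition_K_max: "K_max_partition G K S \<Longrightarrow> KS_partition G K S"
  and KS_partition_S_max: "S_max_partition G K S \<Longrightarrow> KS_partition G K S"
  by (simp_all add: K_max_partition_def S_max_partition_def)

lemmas pair_graph_KS =
  pair_graph_unbalanced pair_graph_balanced KS_partition_K_max KS_partition_S_max

lemma triple_iso_graph_iso: "((G, K, S), (H, L, T)) \<in> triple_iso_rel \<Longrightarrow> (G, H) \<in> graph_iso_rel"
  by (auto simp: triple_iso_rel_def graph_iso_rel_def)

text \<open>The natural target of swing-vertex deletion; it turns out to be the union that the
  theorem speaks of.\<close>

definition unlabeled_KS :: "nat \<Rightarrow> nat KS_triple set set" where
  "unlabeled_KS n =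
     {(G, K, S). pair_graph G \<and> card (pverts G) = n \<and> KS_partition G K S} // triple_iso_rel"

definition unlabeled_balanced :: "nat \<Rightarrow> nat pair_pre_digraph set set" where
  "unlabeled_balanced n = {G. balanced_split_graph G \<and> card (pverts G) = n} // graph_iso_rel"

lemma unlabeled_KS_eq: "unlabeled_KS n = unbalanced_K_max n \<union> unbalanced_S_max n \<union> balanced_KS n"
proof -
  have "{(G, K, S). pair_graph G \<and> card (pverts G) = n \<and> KS_partition G K S} =
    {(G, K, S). unbalanced_split_graph G \<and> card (pverts G) = n \<and> K_max_partition G K S} \<union>
    {(G, K, S). unbalanced_split_graph G \<and> card (pverts G) = n \<and> S_max_partition G K S} \<union>
    {(G, K, S). balanced_split_graph G \<and> card (pverts G) = n \<and> KS_partition G K S}"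
    (is "?A = ?B")
  proof
    show "?A \<subseteq> ?B" using KS_partition_cases by blast
    show "?B \<subseteq> ?A"
      by (auto simp: unbalanced_split_graph_def balanced_split_graph_def split_graph_def
          K_max_partition_def S_max_partition_def)
  qed
  then show ?thesis
    unfolding unlabeled_KS_def unbalanced_K_max_def unbalanced_S_max_def balanced_KS_def
      quotient_Un[symmetric] by (rule arg_cong)
qed

text \<open>The bijection is deletion of a swing vertex from the clique side. It is onto by
  \<open>swing_extension\<close>, and on both sides equivalence of triples amounts to isomorphism of
  the graphs before deletion.\<close>

lemma bij_K_max_unlabeled_KS:
  assumes "n \<ge> 1"
  shows "\<exists>f. bij_betw f (unbalanced_K_max n) (unlabeled_KS (n - 1))"
  unfolding unbalanced_K_max_def unlabeled_KS_def
proof (rule bij_betw_quotients[OF equiv_triple_iso_rel _ equiv_triple_iso_rel])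
  let ?A = "{(G, K, S). unbalanced_split_graph G \<and> card (pverts G) = n \<and> K_max_partition G K S}
    :: nat KS_triple set"
  let ?B = "{(G, K, S). pair_graph G \<and> card (pverts G) = n - 1 \<and> KS_partition G K S}
    :: nat KS_triple set"
  let ?R = "\<lambda>(G, K, S) t. \<exists>x. swing G x \<and> K = insert x (nbrs G x) \<and> S = non_nbrs G x \<and>
    t = swing_triple G x"
  have A: "(G, K, S) \<in> ?A \<longleftrightarrow> pair_graph G \<and> card (pverts G) = n \<and>
    (\<exists>x. swing G x \<and> K = insert x (nbrs G x) \<and> S = non_nbrs G x)" for G K S
    using unbalanced_K_max_iff[of G K S] by auto
  show "?A \<subseteq> {(G, K, S). pair_graph G \<and> KS_partition G K S}"
    by (auto intro: pair_graph_KS)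
  show "?B \<subseteq> {(G, K, S). pair_graph G \<and> KS_partition G K S}" by auto
  show "\<exists>b\<in>?B. ?R a b" if a: "a \<in> ?A" for a
  proof -
    obtain G K S where GKS: "a = (G, K, S)" by (cases a)
    then obtain x where G: "pair_graph G" "card (pverts G) = n"
      and x: "swing G x" "K = insert x (nbrs G x)" "S = non_nbrs G x"
      using a A[of G K S] by blast
    have "swing_triple G x \<in> ?B"
      using G pair_graph_delete_vertex[OF G(1), of x] KS_partition_delete_swing[OF G(1) x(1)]
        x(1) pair_graphD(1)[OF G(1)]
      by (simp add: swing_triple_def swing_def)
    then show ?thesis using GKS x by (intro bexI[of _ "swing_triple G x"]) auto
  qed
  show "\<exists>a\<in>?A. ?R a b" if b: "b \<in> ?B" for b
  proof -
    obtain G K S where GKS: "b = (G, K, S)" by (cases b)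
    then obtain H x where H: "pair_graph H" "swing H x" "swing_triple H x = b"
      using swing_extension[of G K S] b infinite_UNIV_nat by blast
    have "x \<in> pverts H" "card (pverts H - {x}) = n - 1"
      using H b by (auto simp: swing_triple_def swing_def)
    \<comment> \<open>Here \<open>n\<close> must be positive, since \<open>n - 1\<close> is
      truncated subtraction.\<close>
    then have "card (pverts H) = n"
      using pair_graphD(1)[OF H(1)] assms card_Suc_Diff1[of "pverts H" x] by simp
    then have "(H, insert x (nbrs H x), non_nbrs H x) \<in> ?A"
      using A H by blast
    then show ?thesis using H by (intro bexI) auto
  qed
  show "(a, a') \<in> triple_iso_rel \<longleftrightarrow> (b, b') \<in> triple_iso_rel"
    if ab: "a \<in> ?A" "b \<in> ?B" "a' \<in> ?A" "b' \<in> ?B" and R: "?R a b" "?R a' b'" for a b a' b'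
  proof -
    obtain G K S G' K' S' where GKS: "a = (G, K, S)" "a' = (G', K', S')" by (cases a; cases a')
    have "pair_graph G" "pair_graph G'" using ab A GKS by blast+
    then show ?thesis
      using R GKS swing_K_max_iso_iff swing_triple_iso_iff by auto
  qed
qed

text \<open>The partition is forgotten; nothing is lost, by
  \<open>swing_K_max_iso_iff\<close>.\<close>

lemma bij_K_max_unlabeled_unbalanced:
  "\<exists>f. bij_betw f (unbalanced_K_max n) (unlabeled_unbalanced n)"
  unfolding unbalanced_K_max_def unlabeled_unbalanced_def
proof (rule bij_betw_quotients[OF equiv_triple_iso_rel _ equiv_graph_iso_rel])
  let ?A = "{(G, K, S). unbalanced_split_graph G \<and> card (pverts G) = n \<and> K_max_partition G K S}
    :: nat KS_triple set"
  let ?B = "{G. unbalanced_split_graph G \<and> card (pverts G) = n} :: nat pair_pre_digraph set"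
  let ?R = "\<lambda>a G. fst a = G"
  have A: "(G, K, S) \<in> ?A \<longleftrightarrow> pair_graph G \<and> card (pverts G) = n \<and>
    (\<exists>x. swing G x \<and> K = insert x (nbrs G x) \<and> S = non_nbrs G x)" for G K S
    using unbalanced_K_max_iff[of G K S] by auto
  show "?A \<subseteq> {(G, K, S). pair_graph G \<and> KS_partition G K S}"
    by (auto intro: pair_graph_KS)
  show "?B \<subseteq> {G. pair_graph G}" by (auto intro: pair_graph_KS)
  show "\<exists>b\<in>?B. ?R a b" if "a \<in> ?A" for a
    using that by auto
  show "\<exists>a\<in>?A. ?R a G" if G: "G \<in> ?B" for G
  proof -
    obtain x where "pair_graph G" "swing G x" using G by (auto simp: unbalanced_iff_swing)
    then have "(G, insert x (nbrs G x), non_nbrs G x) \<in> ?A" using A G by blast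
    then show ?thesis by (intro bexI) auto
  qed
  show "(a, a') \<in> triple_iso_rel \<longleftrightarrow> (b, b') \<in> graph_iso_rel"
    if ab: "a \<in> ?A" "b \<in> ?B" "a' \<in> ?A" "b' \<in> ?B" and R: "?R a b" "?R a' b'" for a b a' b'
  proof -
    obtain G K S G' K' S' where GKS: "a = (G, K, S)" "a' = (G', K', S')" by (cases a; cases a')
    then obtain x y where "pair_graph G" "pair_graph G'" "swing G x" "K = insert x (nbrs G x)"
      "S = non_nbrs G x" "swing G' y" "K' = insert y (nbrs G' y)" "S' = non_nbrs G' y"
      using ab(1,3) unfolding GKS A by blast
    then show ?thesis
      using R GKS swing_K_max_iso_iff by auto
  qed
qed

lemma bij_S_max_unlabeled_unbalanced:
  "\<exists>f. bij_betw f (unbalanced_S_max n) (unlabeled_unbalanced n)"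
  unfolding unbalanced_S_max_def unlabeled_unbalanced_def
proof (rule bij_betw_quotients[OF equiv_triple_iso_rel _ equiv_graph_iso_rel])
  let ?A = "{(G, K, S). unbalanced_split_graph G \<and> card (pverts G) = n \<and> S_max_partition G K S}
    :: nat KS_triple set"
  let ?B = "{G. unbalanced_split_graph G \<and> card (pverts G) = n} :: nat pair_pre_digraph set"
  let ?R = "\<lambda>a G. fst a = G"
  have A: "(G, K, S) \<in> ?A \<longleftrightarrow> pair_graph G \<and> card (pverts G) = n \<and>
    (\<exists>x. swing G x \<and> K = nbrs G x \<and> S = insert x (non_nbrs G x))" for G K S
    using unbalanced_S_max_iff[of G K S] by auto
  show "?A \<subseteq> {(G, K, S). pair_graph G \<and> KS_partition G K S}"
    by (auto intro: pair_graph_KS)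
  show "?B \<subseteq> {G. pair_graph G}" by (auto intro: pair_graph_KS)
  show "\<exists>b\<in>?B. ?R a b" if "a \<in> ?A" for a
    using that by auto
  show "\<exists>a\<in>?A. ?R a G" if G: "G \<in> ?B" for G
  proof -
    obtain x where "pair_graph G" "swing G x" using G by (auto simp: unbalanced_iff_swing)
    then have "(G, nbrs G x, insert x (non_nbrs G x)) \<in> ?A" using A G by blast
    then show ?thesis by (intro bexI) auto
  qed
  show "(a, a') \<in> triple_iso_rel \<longleftrightarrow> (b, b') \<in> graph_iso_rel"
    if ab: "a \<in> ?A" "b \<in> ?B" "a' \<in> ?A" "b' \<in> ?B" and R: "?R a b" "?R a' b'" for a b a' b'
  proof -
    obtain G K S G' K' S' where GKS: "a = (G, K, S)" "a' = (G', K', S')" by (cases a; cases a')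
    then obtain x y where "pair_graph G" "pair_graph G'" "swing G x" "K = nbrs G x"
      "S = insert x (non_nbrs G x)" "swing G' y" "K' = nbrs G' y" "S' = insert y (non_nbrs G' y)"
      using ab(1,3) unfolding GKS A by blast
    then show ?thesis
      using R GKS swing_S_max_iso_iff by auto
  qed
qed

text \<open>An isomorphism carries a KS-partition to a KS-partition, which in a balanced graph can
  only be the given one. So forgetting the partition is injective on classes.\<close>

lemma bij_balanced_KS_unlabeled_balanced:
  "\<exists>f. bij_betw f (balanced_KS n) (unlabeled_balanced n)"
  unfolding balanced_KS_def unlabeled_balanced_def
proof (rule bij_betw_quotients[OF equiv_triple_iso_rel _ equiv_graph_iso_rel])
  let ?A = "{(G, K, S). balanced_split_graph G \<and> card (pverts G) = n \<and> KS_partition G K S}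
    :: nat KS_triple set"
  let ?B = "{G. balanced_split_graph G \<and> card (pverts G) = n} :: nat pair_pre_digraph set"
  let ?R = "\<lambda>a G. fst a = G"
  show "?A \<subseteq> {(G, K, S). pair_graph G \<and> KS_partition G K S}"
    by (auto intro: pair_graph_KS)
  show "?B \<subseteq> {G. pair_graph G}" by (auto intro: pair_graph_KS)
  show "\<exists>b\<in>?B. ?R a b" if "a \<in> ?A" for a
    using that by auto
  show "\<exists>a\<in>?A. ?R a G" if "G \<in> ?B" for G
    using that by (force simp: balanced_split_graph_def split_graph_def)
  show "(a, a') \<in> triple_iso_rel \<longleftrightarrow> (b, b') \<in> graph_iso_rel"
    if ab: "a \<in> ?A" "b \<in> ?B" "a' \<in> ?A" "b' \<in> ?B" and R: "?R a b" "?R a' b'" for a b a' b'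
  proof -
    obtain K S K' S' where e: "a = (b, K, S)" "a' = (b', K', S')"
      using R by (cases a; cases a') auto
    have p: "balanced_split_graph b'" "KS_partition b K S" "KS_partition b' K' S'"
      "pair_graph b" "pair_graph b'"
      using ab e by (auto simp: balanced_split_graph_def split_graph_def)
    show ?thesis
    proof
      assume "(b, b') \<in> graph_iso_rel"
      then obtain f where f: "is_graph_iso f b b'" by (auto simp: graph_iso_rel_def)
      have q: "KS_partition b' (f ` K) (f ` S)" by (rule KS_partition_image[OF f p(2)])
      then have K: "f ` K = K'" by (rule balanced_partition_unique[OF p(1) _ p(3)])
      then have "f ` S = S'"
        using q p(3) unfolding KS_partition_def by blast
      then show "(a, a') \<in> triple_iso_rel"
        using e p f K by (auto simp: triple_iso_rel_def)
    qed (use e in \<open>auto intro: triple_iso_graph_iso\<close>)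
  qed
qed

text \<open>The clique sides have different sizes: an isomorphism of the triples gives
  \<open>card (nbrs H y) = Suc (card (nbrs G x))\<close>, while one that sends \<open>x\<close> to
  \<open>y\<close> gives equal degrees.\<close>

lemma K_max_S_max_disjoint: "unbalanced_K_max n \<inter> unbalanced_S_max n = {}"
  unfolding unbalanced_K_max_def unbalanced_S_max_def
proof (rule quotient_Int_empty[OF equiv_triple_iso_rel], goal_cases)
  case (3 a b)
  show ?case
  proof
    assume r: "(a, b) \<in> triple_iso_rel"
    obtain G K S H L T where ab: "a = (G, K, S)" "b = (H, L, T)" by (cases a; cases b)
    then obtain x y where G: "pair_graph G" and H: "pair_graph H"
      and x: "swing G x" "K = insert x (nbrs G x)" and y: "swing H y" "L = nbrs H y"
      using 3 unbalanced_K_max_iff[of G K S] unbalanced_S_max_iff[of H L T] by auto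
    obtain f where f: "is_graph_iso f G H" "f ` K = L"
      using r ab by (auto simp: triple_iso_rel_def)
    obtain g where g: "is_graph_iso g G H" "g x = y"
      using swing_iso[OF G H x(1) y(1) f(1)] .
    have V: "x \<in> pverts G" "x \<notin> nbrs G x" "nbrs G x \<subseteq> pverts G" "finite (nbrs G x)"
      using x pair_graphD[OF G]
      by (auto simp: swing_def nbrs_def intro: finite_subset[of _ "pverts G"])
    have "card (f ` K) = card K"
      using V x by (intro card_image inj_on_subset[OF is_graph_iso_inj[OF f(1)]]) auto
    then have "card (f ` K) = Suc (card (nbrs G x))"
      using V x by simp
    moreover have "card (g ` nbrs G x) = card (nbrs G x)"
      using V by (simp add: card_image inj_on_subset[OF is_graph_iso_inj[OF g(1)]])
    ultimately show False
      using nbrs_image[OF G H g(1) V(1)] f(2) y(2) g(2) by simp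
  qed
qed (auto intro: pair_graph_KS)

lemma unbalanced_balanced_KS_disjoint:
  "(unbalanced_K_max n \<union> unbalanced_S_max n) \<inter> balanced_KS n = {}"
  unfolding unbalanced_K_max_def unbalanced_S_max_def balanced_KS_def quotient_Un[symmetric]
proof (rule quotient_Int_empty[OF equiv_triple_iso_rel], goal_cases)
  case (3 a b)
  obtain G K S H L T where ab: "a = (G, K, S)" "b = (H, L, T)" by (cases a; cases b)
  then have "unbalanced_split_graph G" "\<not> unbalanced_split_graph H"
    using 3 by (auto simp: unbalanced_split_graph_def)
  then show ?case
    using ab unbalanced_iso triple_iso_graph_iso by metis
qed (auto intro: pair_graph_KS)

section \<open>Finiteness, the recursion and its summation\<close>

lemma finite_unlabeled_unbalanced: "finite (unlabeled_unbalanced n)"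
  and finite_unlabeled_balanced: "finite (unlabeled_balanced n)"
proof -
  have "{G :: nat pair_pre_digraph. unbalanced_split_graph G \<and> card (pverts G) = n}
      \<subseteq> {G. pair_graph G \<and> card (pverts G) = n}"
    "{G :: nat pair_pre_digraph. balanced_split_graph G \<and> card (pverts G) = n}
      \<subseteq> {G. pair_graph G \<and> card (pverts G) = n}"
    by (auto intro: pair_graph_KS)
  then show "finite (unlabeled_unbalanced n)" "finite (unlabeled_balanced n)"
    unfolding unlabeled_unbalanced_def unlabeled_balanced_def
    by (simp_all only: finite_subset[OF quotient_mono finite_unlabeled_graphs])
qed

text \<open>The classes of \<open>K\<close>-max triples on \<open>Suc n\<close> vertices are counted
  twice: by forgetting the partition and by deleting a swing vertex. The factor 2 stands for the
  \<open>K\<close>-max and the \<open>S\<close>-max triples on \<open>n\<close> vertices.\<close>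

lemma card_unlabeled_unbalanced_Suc:
  "card (unlabeled_unbalanced (Suc n)) = 2 * card (unlabeled_unbalanced n) + card (unlabeled_balanced n)"
proof -
  obtain f g h k l where b: "bij_betw f (unbalanced_K_max (Suc n)) (unlabeled_KS n)"
    "bij_betw g (unbalanced_K_max (Suc n)) (unlabeled_unbalanced (Suc n))"
    "bij_betw h (unbalanced_K_max n) (unlabeled_unbalanced n)"
    "bij_betw k (unbalanced_S_max n) (unlabeled_unbalanced n)"
    "bij_betw l (balanced_KS n) (unlabeled_balanced n)"
    using bij_K_max_unlabeled_KS[of "Suc n"] bij_K_max_unlabeled_unbalanced[of "Suc n"]
      bij_K_max_unlabeled_unbalanced[of n] bij_S_max_unlabeled_unbalanced[of n]
      bij_balanced_KS_unlabeled_balanced[of n]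
    by auto
  have fin: "finite (unbalanced_K_max n)" "finite (unbalanced_S_max n)" "finite (balanced_KS n)"
    using b(3-5) finite_unlabeled_unbalanced finite_unlabeled_balanced bij_betw_finite by metis+
  have "card (unlabeled_unbalanced (Suc n)) = card (unlabeled_KS n)"
    using b(1,2) bij_betw_same_card by metis
  also have "\<dots> = card (unbalanced_K_max n) + card (unbalanced_S_max n) + card (balanced_KS n)"
    using fin K_max_S_max_disjoint[of n] unbalanced_balanced_KS_disjoint[of n]
    by (simp add: unlabeled_KS_eq card_Un_disjoint)
  finally show ?thesis
    using b(3-5)[THEN bij_betw_same_card] by simp
qed

text \<open>The start of the recursion: the null graph has no vertex that could be swing.\<close>

lemma card_unlabeled_unbalanced_0: "card (unlabeled_unbalanced 0) = 0"
proof -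
  have "card (pverts G) \<noteq> 0" if u: "unbalanced_split_graph G" for G :: "nat pair_pre_digraph"
  proof -
    obtain x where "pair_graph G" "x \<in> pverts G"
      using u by (auto simp: unbalanced_iff_swing swing_def)
    then show ?thesis using pair_graphD(1)[of G] by (auto simp: card_eq_0_iff)
  qed
  then have eq: "{G :: nat pair_pre_digraph. unbalanced_split_graph G \<and> card (pverts G) = 0} = {}"
    by blast
  show ?thesis unfolding unlabeled_unbalanced_def eq by simp
qed

lemma card_unlabeled_split:
  "card ({G. split_graph G \<and> card (pverts G) = n} // graph_iso_rel) =
     card (unlabeled_unbalanced n) + card (unlabeled_balanced n)"
proof -
  have "{G :: nat pair_pre_digraph. split_graph G \<and> card (pverts G) = n} =
    {G. unbalanced_split_graph G \<and> card (pverts G) = n} \<union>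
    {G. balanced_split_graph G \<and> card (pverts G) = n}"
    by (auto simp: unbalanced_split_graph_def balanced_split_graph_def)
  then have "{G. split_graph G \<and> card (pverts G) = n} // graph_iso_rel =
    unlabeled_unbalanced n \<union> unlabeled_balanced n"
    unfolding unlabeled_unbalanced_def unlabeled_balanced_def quotient_Un[symmetric]
    by (rule arg_cong)
  moreover have "unlabeled_unbalanced n \<inter> unlabeled_balanced n = {}"
    unfolding unlabeled_unbalanced_def unlabeled_balanced_def
  proof (rule quotient_Int_empty[OF equiv_graph_iso_rel], goal_cases)
    case (3 G H)
    then show ?case using unbalanced_iso by (auto simp: unbalanced_split_graph_def)
  qed (auto intro: pair_graph_KS)
  ultimately show ?thesis
    using finite_unlabeled_unbalanced finite_unlabeled_balanced by (simp add: card_Un_disjoint)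
qed

text \<open>The recursion says that passing from \<open>Suc n\<close> to \<open>Suc (Suc n)\<close>
  vertices adds the number of all split graphs on \<open>Suc n\<close> vertices; the sum
  telescopes.\<close>

lemma card_unlabeled_unbalanced: "card (unlabeled_unbalanced (Suc n)) = card (unlabeled_split_le n)"
proof (induction n)
  case 0
  \<comment> \<open>The one unbalanced class on one vertex comes from the split graphs on no
    vertices, which are all balanced.\<close>
  then show ?case
    using card_unlabeled_split[of 0] card_unlabeled_unbalanced_Suc[of 0] card_unlabeled_unbalanced_0
    by (simp add: unlabeled_split_le_def)
next
  case (Suc n)
  let ?T = "{G :: nat pair_pre_digraph. split_graph G \<and> card (pverts G) = Suc n}"
  let ?L = "{G :: nat pair_pre_digraph. split_graph G \<and> card (pverts G) \<le> n}"
  have "{G. split_graph G \<and> card (pverts G) \<le> Suc n} = ?L \<union> ?T" by auto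
  then have eq: "unlabeled_split_le (Suc n) = unlabeled_split_le n \<union> ?T // graph_iso_rel"
    unfolding unlabeled_split_le_def quotient_Un[symmetric] by (rule arg_cong)
  have disj: "unlabeled_split_le n \<inter> ?T // graph_iso_rel = {}"
    unfolding unlabeled_split_le_def
    by (rule quotient_Int_empty[OF equiv_graph_iso_rel])
      (auto simp: split_graph_def graph_iso_rel_def dest: is_graph_iso_card)
  \<comment> \<open>Only the finitely many orders \<open>m \<le> n\<close> occur, each with finitely
    many classes.\<close>
  have "?L \<subseteq> (\<Union>m\<le>n. {G. pair_graph G \<and> card (pverts G) = m})"
    by (auto simp: split_graph_def)
  then have "unlabeled_split_le n \<subseteq>
      (\<Union>m\<le>n. {G. pair_graph G \<and> card (pverts G) = m} // graph_iso_rel)"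
    unfolding unlabeled_split_le_def quotient_def by blast
  then have fin: "finite (unlabeled_split_le n)"
    by (rule finite_subset) (simp add: finite_unlabeled_graphs)
  have "finite (?T // graph_iso_rel)"
    by (rule finite_subset[OF quotient_mono finite_unlabeled_graphs[of "Suc n"]])
      (auto simp: split_graph_def)
  then have "card (unlabeled_split_le (Suc n)) =
      card (unlabeled_split_le n) + card (?T // graph_iso_rel)"
    using fin disj by (simp add: eq card_Un_disjoint)
  then show ?case
    using Suc card_unlabeled_split[of "Suc n"] card_unlabeled_unbalanced_Suc[of "Suc n"] by simp
qed

theorem theorem4p7:
  fixes n :: nat
  assumes "n \<ge> 1"
  shows "(\<exists>f. bij_betw f (unbalanced_K_max n)
            (unbalanced_K_max (n - 1) \<union> unbalanced_S_max (n - 1) \<union> balanced_KS (n - 1)))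
         \<and> card (unlabeled_unbalanced n) = card (unlabeled_split_le (n - 1))"
  using bij_K_max_unlabeled_KS[OF assms] card_unlabeled_unbalanced[of "n - 1"] assms
  by (simp add: unlabeled_KS_eq)

end
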